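(* Let $n \ge 2$ be an integer. For $\mathbf{p} \in \mathcal{P}_n$ put $\bar{\mathbf{v}}_n(\mathbf{p}) := \mathbf{v}_n\bigl(H_{\mathbf{v}_n}^{-1}(H(\mathbf{p}))\bigr)$ and $\bar{\mathbf{w}}_n(\mathbf{p}) := \mathbf{w}_n\bigl(H_{\mathbf{w}_n}^{-1}(H(\mathbf{p}))\bigr)$. Then for every $n \ge 2$, every $\mathbf{p} \in \mathcal{P}_n$ and every $\alpha \in (0,\infty)$, $$\|\bar{\mathbf{w}}_n(\mathbf{p})\|_\alpha \le \|\mathbf{p}\|_\alpha \le \|\bar{\mathbf{v}}_n(\mathbf{p})\|_\alpha .$$
   Context: $\mathcal{P}_n = \{(p_1,\dots,p_n)\in\mathbb{R}^n : p_i \ge 0,\ \sum_{i=1}^n p_i = 1\}$. The Shannon entropy is $H(\mathbf{p}) = -\sum_{i=1}^n p_i \ln p_i$ with $0\ln 0 = 0$ (natural logarithm). For $\alpha\in(0,\infty)$, $\|\mathbf{p}\|_\alpha = \bigl(\sum_{i=1}^n p_i^\alpha\bigr)^{1/\alpha}$. For $p\in[0,\frac1{n-1}]$, $\mathbf{v}_n(p) = (1-(n-1)p,\, p,\, \dots,\, p) \in \mathcal{P}_n$. For $p \in [\frac1n, 1]$, $\mathbf{w}_n(p) = (w_1(p),\dots,w_n(p)) \in \mathcal{P}_n$ with $w_i(p) = p$ if $1\le i\le \lfloor p^{-1}\rfloor$, $w_i(p) = 1-\lfloor p^{-1}\rfloor p$ if $i = \lfloor p^{-1}\rfloor + 1$,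 and $w_i(p)=0$ otherwise. Write $H_{\mathbf{v}_n}(p) = H(\mathbf{v}_n(p))$ and $H_{\mathbf{w}_n}(p) = H(\mathbf{w}_n(p))$. The function $H_{\mathbf{v}_n}$ is a continuous strictly increasing bijection $[0,\frac1n]\to[0,\ln n]$, with inverse $H_{\mathbf{v}_n}^{-1}:[0,\ln n]\to[0,\frac1n]$; the function $H_{\mathbf{w}_n}$ is a continuous strictly decreasing bijection $[\frac1n,1]\to[0,\ln n]$, with inverse $H_{\mathbf{w}_n}^{-1}:[0,\ln n]\to[\frac1n,1]$. *)

theory Defs
  imports Complex_Main
begin

(* A vector in R^n is a function nat => real of which only the values at 1, ..., n matter:
   every notion below that takes a vector p reads p i only for i in {1..n}. *)

definition prob_simplex :: "nat \<Rightarrow> (nat \<Rightarrow> real) set" where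
  "prob_simplex n = {p. (\<forall>i\<in>{1..n}. 0 \<le> p i) \<and> (\<Sum>i=1..n. p i) = 1}"

(* The convention 0 ln 0 = 0 holds because of the factor 0. *)
definition shannon_entropy :: "nat \<Rightarrow> (nat \<Rightarrow> real) \<Rightarrow> real" where
  "shannon_entropy n p = - (\<Sum>i=1..n. p i * ln (p i))"

(* For nonnegative p and alpha > 0; 0 powr a = 0 then agrees with 0^alpha = 0. *)
definition alpha_norm :: "nat \<Rightarrow> real \<Rightarrow> (nat \<Rightarrow> real) \<Rightarrow> real" where
  "alpha_norm n \<alpha> p = (\<Sum>i=1..n. p i powr \<alpha>) powr (1 / \<alpha>)"

definition v_vec :: "nat \<Rightarrow> real \<Rightarrow> nat \<Rightarrow> real" where
  "v_vec n p i = (if i = 1 then 1 - (real n - 1) * p else p)"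

(* The entries do not depend on n; n only fixes how many of them are used. *)
definition w_vec :: "nat \<Rightarrow> real \<Rightarrow> nat \<Rightarrow> real" where
  "w_vec n p i =
     (if 1 \<le> i \<and> int i \<le> \<lfloor>1 / p\<rfloor> then p
      else if int i = \<lfloor>1 / p\<rfloor> + 1 then 1 - of_int \<lfloor>1 / p\<rfloor> * p
      else 0)"

definition H_v :: "nat \<Rightarrow> real \<Rightarrow> real" where
  "H_v n p = shannon_entropy n (v_vec n p)"

definition H_w :: "nat \<Rightarrow> real \<Rightarrow> real" where
  "H_w n p = shannon_entropy n (w_vec n p)"

(* For n >= 2, H_v n maps [0, 1/n] bijectively and increasingly onto [0, ln n], and H_w n maps
   [1/n, 1] bijectively and decreasingly onto [0, ln n]; on [0, ln n] the following are the
   inverses of these restrictions. *)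
definition H_v_inv :: "nat \<Rightarrow> real \<Rightarrow> real" where
  "H_v_inv n = inv_into {0..1 / real n} (H_v n)"

definition H_w_inv :: "nat \<Rightarrow> real \<Rightarrow> real" where
  "H_w_inv n = inv_into {1 / real n..1} (H_w n)"

definition v_bar :: "nat \<Rightarrow> (nat \<Rightarrow> real) \<Rightarrow> nat \<Rightarrow> real" where
  "v_bar n p = v_vec n (H_v_inv n (shannon_entropy n p))"

definition w_bar :: "nat \<Rightarrow> (nat \<Rightarrow> real) \<Rightarrow> nat \<Rightarrow> real" where
  "w_bar n p = w_vec n (H_w_inv n (shannon_entropy n p))"

end

theory Submission
  imports Defs "HOL-Analysis.Convex" "HOL-Real_Asymp.Real_Asymp"
begin

text \<open>
  The function \<open>D x = x powr \<alpha> - l * (x * ln x) - m * x\<close> has as its derivative a convex function of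
  \<open>ln x\<close>, so \<open>l\<close> and \<open>m\<close> can be chosen to make \<open>D\<close> increase on \<open>[0, \<beta>]\<close>, decrease on
  \<open>[\<beta>, \<gamma>]\<close> and increase beyond \<open>\<gamma>\<close>. For two probability vectors of equal entropy, comparing the
  sums of \<open>D\<close> is comparing the sums of the \<open>\<alpha>\<close>-th powers. For the upper bound, \<open>\<beta>\<close> is the repeated
  entry of the vector \<open>v\<close> and \<open>\<gamma>\<close> the largest entry of \<open>p\<close>; for the lower bound, \<open>\<gamma>\<close> is the repeated
  entry of \<open>w\<close>, occurring \<open>k\<close> times, and \<open>\<beta>\<close> the \<open>(k + 1)\<close>-st largest entry of \<open>p\<close>. With these
  choices the sums of \<open>D\<close> compare term by term. Where \<open>\<beta>\<close> would be \<open>0\<close> (or \<open>k = n\<close>), equality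
  of the entropies forces the power sums to agree.
\<close>

section \<open>Shape of the comparison function\<close>

lemma continuous_on_x_ln_x: "continuous_on {0..} (\<lambda>x::real. x * ln x)"
  unfolding continuous_on_def
proof
  fix x :: real
  assume x: "x \<in> {0..}"
  show "((\<lambda>x. x * ln x) \<longlongrightarrow> x * ln x) (at x within {0..})"
  proof (cases "x = 0")
    case False
    then show ?thesis using x by (auto intro!: tendsto_intros)
  next
    case True
    have "((\<lambda>x::real. x * ln x) \<longlongrightarrow> 0) (at_right 0)"
      by real_asymp
    then show ?thesis
      using True by (simp add: at_within_Ici_at_right)
  qed
qed

text \<open>Between the zeros \<open>f\<close> lies below its chord, which is zero. Outside, the
  nearer zero lies between \<open>u\<close> and the farther zero, so the chord joining these two is
  nonnegative there; its value is a positive multiple of \<open>f u\<close>.\<close>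

lemma convex_sign_between_zeros:
  fixes f :: "real \<Rightarrow> real"
  assumes "convex_on UNIV f" "f s = 0" "f t = 0" "s < t"
  shows "s \<le> u \<Longrightarrow> u \<le> t \<Longrightarrow> f u \<le> 0"
    and "u \<le> s \<Longrightarrow> 0 \<le> f u"
    and "t \<le> u \<Longrightarrow> 0 \<le> f u"
proof -
  have convex: "convex_on {x..y} f" for x y
    using assms(1) by (rule convex_on_subset) auto
  show "f u \<le> 0" if "s \<le> u" "u \<le> t"
    using convex_onD_Icc'[OF convex, of u s t] that assms by simp
  show "0 \<le> f u" if "u \<le> s"
  proof -
    have "0 \<le> (0 - f u) / (t - u) * (s - u) + f u"
      using convex_onD_Icc'[OF convex, of s u t] that assms by simp
    also have "\<dots> = f u * ((t - s) / (t - u))"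
      using that assms by (simp add: field_simps)
    finally show ?thesis
      using that assms by (simp add: zero_le_mult_iff zero_le_divide_iff)
  qed
  show "0 \<le> f u" if "t \<le> u"
  proof -
    have "0 \<le> (0 - f u) / (u - s) * (u - t) + f u"
      using convex_onD_Icc''[OF convex, of t s u] that assms by simp
    also have "\<dots> = f u * ((t - s) / (u - s))"
      using that assms by (simp add: field_simps)
    finally show ?thesis
      using that assms by (simp add: zero_le_mult_iff zero_le_divide_iff)
  qed
qed

text \<open>The rise, fall and rise of \<open>D\<close> is recorded through its extremal
  consequences: \<open>D 0 = 0\<close> gives nonnegativity up to \<beta>, the peak at \<beta>
  dominates everything up to \<gamma>, and the valley at \<gamma> is minimal from \<beta>
  on.\<close>

lemma powr_entropy_comparison:
  fixes \<alpha> \<beta> \<gamma> :: real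
  assumes "0 < \<alpha>" "0 < \<beta>" "\<beta> < \<gamma>"
  obtains l m where
    "\<And>x. 0 \<le> x \<Longrightarrow> x \<le> \<beta> \<Longrightarrow> 0 \<le> x powr \<alpha> - l * (x * ln x) - m * x"
    "\<And>x. 0 \<le> x \<Longrightarrow> x \<le> \<gamma> \<Longrightarrow>
      x powr \<alpha> - l * (x * ln x) - m * x \<le> \<beta> powr \<alpha> - l * (\<beta> * ln \<beta>) - m * \<beta>"
    "\<And>x. \<beta> \<le> x \<Longrightarrow>
      \<gamma> powr \<alpha> - l * (\<gamma> * ln \<gamma>) - m * \<gamma> \<le> x powr \<alpha> - l * (x * ln x) - m * x"
proof -
  \<comment> \<open>\<open>e (ln x)\<close> is the derivative of \<open>x powr \<alpha>\<close>. The
    constants \<open>l\<close> and \<open>m\<close> make \<open>l * (u + 1) + m\<close> the chord of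
    \<open>e\<close> through \<open>ln \<beta>\<close> and \<open>ln \<gamma>\<close>, where
    \<open>u + 1\<close> at \<open>u = ln x\<close> is the derivative of \<open>x * ln x\<close>. So
    \<psi> is \<open>e\<close> minus a chord, and \<open>D\<close> has derivative
    \<open>\<psi> (ln x)\<close>.\<close>
  define e where "e u = \<alpha> * exp ((\<alpha> - 1) * u)" for u :: real
  define l where "l = (e (ln \<gamma>) - e (ln \<beta>)) / (ln \<gamma> - ln \<beta>)"
  define m where "m = e (ln \<beta>) - l * (ln \<beta> + 1)"
  define \<psi> where "\<psi> u = e u - l * (u + 1) - m" for u :: real
  define D where "D x = x powr \<alpha> - l * (x * ln x) - m * x" for x :: real
  have ln_less: "ln \<beta> < ln \<gamma>"
    using assms by simp
  have zeros: "\<psi> (ln \<beta>) = 0" "\<psi> (ln \<gamma>) = 0"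
    using ln_less by (simp_all add: \<psi>_def m_def l_def field_simps)
  have "convex_on UNIV \<psi>"
  proof (rule f''_ge0_imp_convex)
    show "(\<psi> has_real_derivative \<alpha> * (\<alpha> - 1) * exp ((\<alpha> - 1) * u) - l) (at u)" for u
      unfolding \<psi>_def e_def by (auto intro!: derivative_eq_intros)
    show "((\<lambda>u. \<alpha> * (\<alpha> - 1) * exp ((\<alpha> - 1) * u) - l) has_real_derivative
        \<alpha> * (\<alpha> - 1)\<^sup>2 * exp ((\<alpha> - 1) * u)) (at u)" for u
      by (auto intro!: derivative_eq_intros simp: power2_eq_square)
  qed (use assms in auto)
  note sign = convex_sign_between_zeros[OF this zeros ln_less]
  have deriv: "(D has_real_derivative \<psi> (ln x)) (at x)" if "0 < x" for x
  proof -
    have "(D has_real_derivative \<alpha> * x powr (\<alpha> - 1) - l * (ln x + 1) - m) (at x)"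
      unfolding D_def using that
      by (auto intro!: derivative_eq_intros simp: powr_diff field_simps)
    then show ?thesis
      using that by (simp add: \<psi>_def e_def powr_def)
  qed
  have "continuous_on {0..} D"
    unfolding D_def using assms
    by (intro continuous_intros continuous_on_x_ln_x continuous_on_powr') auto
  then have cont: "continuous_on {x..y} D" if "0 \<le> x" for x y
    by (rule continuous_on_subset) (use that in auto)
  \<comment> \<open>Derivatives are taken at interior points; at the endpoint 0, where
    \<open>deriv\<close> says nothing, continuity of \<open>D\<close> suffices.\<close>
  have inc_low: "D x \<le> D y" if "0 \<le> x" "x \<le> y" "y \<le> \<beta>" for x y
  proof (rule DERIV_nonneg_imp_increasing_open[where f = D])
    fix z assume "x < z" "z < y"
    then show "\<exists>d. (D has_real_derivative d) (at z) \<and> 0 \<le> d"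
      using that deriv[of z] sign(2)[of "ln z"] by (intro exI[of _ "\<psi> (ln z)"]) auto
  qed (use that cont in auto)
  have dec: "D y \<le> D x" if "\<beta> \<le> x" "x \<le> y" "y \<le> \<gamma>" for x y
  proof (rule DERIV_nonpos_imp_decreasing_open[where f = D])
    fix z assume "x < z" "z < y"
    then show "\<exists>d. (D has_real_derivative d) (at z) \<and> d \<le> 0"
      using that assms deriv[of z] sign(1)[of "ln z"] by (intro exI[of _ "\<psi> (ln z)"]) auto
  qed (use that assms cont in auto)
  have inc_high: "D x \<le> D y" if "\<gamma> \<le> x" "x \<le> y" for x y
  proof (rule DERIV_nonneg_imp_increasing_open[where f = D])
    fix z assume "x < z" "z < y"
    then show "\<exists>d. (D has_real_derivative d) (at z) \<and> 0 \<le> d"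
      using that assms deriv[of z] sign(3)[of "ln z"] by (intro exI[of _ "\<psi> (ln z)"]) auto
  qed (use that assms cont in auto)
  have "0 \<le> D x" if "0 \<le> x" "x \<le> \<beta>" for x
    using inc_low[of 0 x] that by (simp add: D_def)
  moreover have "D x \<le> D \<beta>" if "0 \<le> x" "x \<le> \<gamma>" for x
    using inc_low[of x \<beta>] dec[of \<beta> x] that by (cases "x \<le> \<beta>") auto
  moreover have "D \<gamma> \<le> D x" if "\<beta> \<le> x" for x
    using dec[of x \<gamma>] inc_high[of \<gamma> x] that by (cases "x \<le> \<gamma>") auto
  ultimately show ?thesis
    using that[of l m] unfolding D_def by blast
qed

section \<open>Tangent bounds for \<open>x * ln x\<close>\<close>

text \<open>The tangent of \<open>x * ln x\<close> at \<open>c\<close> has slope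
  \<open>ln c + 1\<close> and intercept \<open>- c\<close>. For positive \<open>x\<close> the height
  above it is \<open>x\<close> times the gap in \<open>ln y \<le> y - 1\<close> at
  \<open>y = c / x\<close>, and this gap closes only at \<open>y = 1\<close>.\<close>

lemma x_ln_x_tangent:
  fixes c x :: real
  assumes "0 < c" "0 \<le> x"
  shows "- c \<le> x * ln x - (ln c + 1) * x"
    and "x * ln x - (ln c + 1) * x = - c \<Longrightarrow> x = c"
proof -
  have eq: "x * ln x - (ln c + 1) * x + c = x * ((c / x - 1) - ln (c / x))" if "0 < x"
    using that assms by (simp add: ln_div field_simps)
  show "- c \<le> x * ln x - (ln c + 1) * x"
  proof (cases "x = 0")
    case False
    then have "0 \<le> x * ((c / x - 1) - ln (c / x))"
      using assms ln_le_minus_one[of "c / x"] by simp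
    then show ?thesis using eq False assms by simp
  qed (use assms in simp)
  show "x = c" if *: "x * ln x - (ln c + 1) * x = - c"
  proof (cases "x = 0")
    case False
    then have "x * ((c / x - 1) - ln (c / x)) = 0"
      using eq * assms by simp
    then have "c / x = 1"
      using False assms ln_eq_minus_one[of "c / x"] by simp
    then show ?thesis using False by simp
  qed (use * assms in simp)
qed

text \<open>The derivative at \<open>z\<close> is \<open>ln z - ln a\<close>, positive beyond
  \<open>a\<close>. This serves to exclude that the largest entry of \<open>p\<close> exceeds the
  large entry \<open>b\<close> of the upper extremal vector.\<close>

lemma x_ln_x_tangent_strict_mono:
  fixes a x y :: real
  assumes "0 < a" "a \<le> x" "x < y"
  shows "x * ln x - (ln a + 1) * x < y * ln y - (ln a + 1) * y"
proof (rule DERIV_pos_imp_increasing_open[where f = "\<lambda>x. x * ln x - (ln a + 1) * x"])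
  fix z assume "x < z" "z < y"
  then show "\<exists>d. ((\<lambda>x. x * ln x - (ln a + 1) * x) has_real_derivative d) (at z) \<and> 0 < d"
    using assms by (intro exI[of _ "ln z - ln a"]) (auto intro!: derivative_eq_intros)
next
  have "continuous_on {x..y} (\<lambda>x. x * ln x)"
    using continuous_on_x_ln_x by (rule continuous_on_subset) (use assms in auto)
  then show "continuous_on {x..y} (\<lambda>x. x * ln x - (ln a + 1) * x)"
    by (intro continuous_on_diff) (auto intro!: continuous_intros)
qed (use assms in simp)

section \<open>Upper bound for power sums at given entropy\<close>

text \<open>Splits a sum of values of \<open>D\<close> into power sum, entropy part and total; the
  last two cancel when vectors of equal entropy and total are compared.\<close>

lemma sum_affine:
  fixes f :: "'a \<Rightarrow> real"
  shows "(\<Sum>i\<in>A. f i - l * g i - m * h i) = sum f A - l * sum g A - m * sum h A"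
  by (simp add: sum_subtractf sum_distrib_left)

text \<open>The largest entry \<open>p j\<close> is paired with \<open>b\<close>, every other entry
  with \<open>a\<close>, and the values of \<open>D\<close> with \<beta> = \<open>a\<close> and
  \<gamma> = \<open>p j\<close> are compared within each pair.\<close>

lemma sum_powr_le_of_equal_entropy:
  fixes p :: "'a \<Rightarrow> real" and a b \<alpha> :: real
  assumes fin: "finite S" and j: "j \<in> S" and alpha: "0 < \<alpha>"
    and nonneg: "\<And>i. i \<in> S \<Longrightarrow> 0 \<le> p i" and max: "\<And>i. i \<in> S \<Longrightarrow> p i \<le> p j"
    and a: "0 \<le> a" "a \<le> b"
    and sum: "(\<Sum>i\<in>S. p i) = real (card S - 1) * a + b"
    and one: "real (card S - 1) * a + b = 1"
    and entropy: "(\<Sum>i\<in>S. p i * ln (p i)) = real (card S - 1) * (a * ln a) + b * ln b"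
  shows "(\<Sum>i\<in>S. p i powr \<alpha>) \<le> real (card S - 1) * a powr \<alpha> + b powr \<alpha>"
proof -
  define T where "T = S - {j}"
  have T: "finite T" "card T = card S - 1" "\<And>i. i \<in> T \<Longrightarrow> i \<in> S"
    using fin j by (auto simp: T_def)
  have split: "sum f S = f j + sum f T" for f :: "'a \<Rightarrow> real"
    unfolding T_def using fin j by (rule sum.remove)
  have total: "p j + sum p T = real (card T) * a + b"
    using sum split[of p] T by simp
  have entropy': "p j * ln (p j) + (\<Sum>i\<in>T. p i * ln (p i)) = real (card T) * (a * ln a) + b * ln b"
    using entropy split[of "\<lambda>i. p i * ln (p i)"] T by simp
  show ?thesis
  proof (cases "a = 0")
    case True
    then have "b = 1" using one by simp
    \<comment> \<open>Here the entropy is 0, being that of a unit vector. All terms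
      \<open>p i * ln (p i)\<close> have the same sign, so each vanishes and every entry is 0 or 1,
      hence equal to its own \<alpha>-th power.\<close>
    have le_1: "p i \<le> 1" if "i \<in> S" for i
      using member_le_sum[OF that, of p] nonneg fin sum one by auto
    have nonpos: "p i * ln (p i) \<le> 0" if "i \<in> S" for i
      using le_1[OF that] nonneg[OF that] by (cases "p i = 0") (auto simp: mult_nonneg_nonpos)
    have "(\<Sum>i\<in>S. - (p i * ln (p i))) = 0"
      using entropy True \<open>b = 1\<close> by (simp add: sum_negf)
    then have "p i * ln (p i) = 0" if "i \<in> S" for i
      using nonpos that fin by (subst (asm) sum_nonneg_eq_0_iff) auto
    then have "p i = 0 \<or> p i = 1" if "i \<in> S" for i
      using that nonneg[OF that] by (metis ln_eq_zero_iff mult_eq_0_iff order_le_less)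
    then have "(\<Sum>i\<in>S. p i powr \<alpha>) = sum p S"
      by (intro sum.cong) force+
    then show ?thesis using sum True \<open>b = 1\<close> by simp
  next
    case False
    then have "0 < a" using a by simp
    \<comment> \<open>Otherwise \<open>p\<close> strictly majorizes \<open>(b, a, \<dots>, a)\<close>, against the equality of entropies.\<close>
    have "b \<ge> p j"
    proof (rule ccontr)
      assume "\<not> b \<ge> p j"
      then have "b < p j" by simp
      let ?\<phi> = "\<lambda>x. x * ln x - (ln a + 1) * x"
      have "?\<phi> b < ?\<phi> (p j)"
        using \<open>0 < a\<close> a \<open>b < p j\<close> by (intro x_ln_x_tangent_strict_mono) auto
      moreover have "real (card T) * - a \<le> (\<Sum>i\<in>T. ?\<phi> (p i))"
        using x_ln_x_tangent(1)[OF \<open>0 < a\<close>] nonneg T by (intro sum_bounded_below) auto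
      moreover have "(\<Sum>i\<in>T. ?\<phi> (p i)) = (\<Sum>i\<in>T. p i * ln (p i)) - (ln a + 1) * sum p T"
        by (simp add: sum_subtractf sum_distrib_left)
      moreover have "(ln a + 1) * (p j + sum p T) = (ln a + 1) * (real (card T) * a + b)"
        using total by simp
      ultimately show False
        using entropy' by (simp add: algebra_simps)
    qed
    show ?thesis
    proof (cases "p j \<le> a")
      \<comment> \<open>The comparison function needs \<open>a < p j\<close>. If no entry exceeds
        \<open>a\<close>, the total, at least \<open>card S * a\<close> because
        \<open>a \<le> b\<close>, leaves only the constant vector, with
        \<open>a = b\<close>.\<close>
      case True
      then have eq: "p j = b" and "p j = a" using \<open>b \<ge> p j\<close> a total
        sum_bounded_above[of T p a] max T by force+
      then have "(\<Sum>i\<in>T. a - p i) = 0" using total by (simp add: sum_subtractf)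
      then have "p i = a" if "i \<in> T" for i
        using that T max \<open>p j = a\<close> by (subst (asm) sum_nonneg_eq_0_iff) force+
      then have "(\<Sum>i\<in>T. p i powr \<alpha>) = real (card T) * a powr \<alpha>" by simp
      then show ?thesis using split[of "\<lambda>i. p i powr \<alpha>"] eq T by simp
    next
      case False
      then obtain l m where
        le: "\<And>x. 0 \<le> x \<Longrightarrow> x \<le> p j \<Longrightarrow>
          x powr \<alpha> - l * (x * ln x) - m * x \<le> a powr \<alpha> - l * (a * ln a) - m * a"
        and ge: "\<And>x. a \<le> x \<Longrightarrow>
          p j powr \<alpha> - l * (p j * ln (p j)) - m * p j \<le> x powr \<alpha> - l * (x * ln x) - m * x"
        using powr_entropy_comparison[OF alpha \<open>0 < a\<close>, of "p j"] by (metis not_le)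
      \<comment> \<open>Entries in \<open>T\<close> lie in the range up to \<open>p j\<close> where
        \<open>a\<close> is the maximum of \<open>D\<close>. For the remaining pair,
        \<open>b\<close> lies beyond \<open>a\<close>, where \<open>p j\<close> is the minimum of
        \<open>D\<close>.\<close>
      have "(\<Sum>i\<in>T. p i powr \<alpha> - l * (p i * ln (p i)) - m * p i)
          \<le> real (card T) * (a powr \<alpha> - l * (a * ln a) - m * a)"
        using T nonneg max by (intro sum_bounded_above le) auto
      moreover have "l * (p j * ln (p j) + (\<Sum>i\<in>T. p i * ln (p i)))
          = l * (real (card T) * (a * ln a) + b * ln b)"
        using entropy' by simp
      moreover have "m * (p j + sum p T) = m * (real (card T) * a + b)"
        using total by simp
      ultimately have "p j powr \<alpha> + (\<Sum>i\<in>T. p i powr \<alpha>) \<le> real (card T) * a powr \<alpha> + b powr \<alpha>"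
        using ge[OF a(2)] unfolding sum_affine by (simp add: algebra_simps)
      then show ?thesis using split[of "\<lambda>i. p i powr \<alpha>"] T by simp
    qed
  qed
qed

section \<open>Lower bound for power sums at given entropy\<close>

lemma finite_arg_max:
  fixes p :: "'a \<Rightarrow> 'b::linorder"
  assumes "finite S" "S \<noteq> {}"
  obtains m where "m \<in> S" "\<And>i. i \<in> S \<Longrightarrow> p i \<le> p m"
proof -
  have "Max (p ` S) \<in> p ` S"
    using assms by (intro Max_in) auto
  then obtain m where "m \<in> S" "Max (p ` S) = p m" by blast
  then show ?thesis
    using that[of m] assms by (metis Max_ge finite_imageI imageI)
qed

text \<open>Takes the place of sorting: \<open>A\<close> holds the \<open>k\<close> largest entries,
  ties being broken arbitrarily. The induction moves a maximum of the remaining entries into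
  \<open>A\<close>.\<close>

lemma finite_largest_subset:
  fixes p :: "'a \<Rightarrow> 'b::linorder"
  assumes "finite S" "k \<le> card S"
  obtains A where "A \<subseteq> S" "card A = k" "\<And>i j. i \<in> A \<Longrightarrow> j \<in> S - A \<Longrightarrow> p j \<le> p i"
  using assms(2)
proof (induction k arbitrary: thesis)
  case 0
  show ?case by (rule 0(1)[of "{}"]) auto
next
  case (Suc k)
  obtain A where A: "A \<subseteq> S" "card A = k" "\<And>i j. i \<in> A \<Longrightarrow> j \<in> S - A \<Longrightarrow> p j \<le> p i"
    using Suc.IH Suc.prems(2) by (metis Suc_leD)
  have "finite A" using A(1) assms(1) finite_subset by blast
  have "S - A \<noteq> {}" using A Suc.prems(2) by (metis Diff_eq_empty_iff Suc_n_not_le_n subset_antisym)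
  then obtain m where m: "m \<in> S - A" "\<And>j. j \<in> S - A \<Longrightarrow> p j \<le> p m"
    using finite_arg_max[of "S - A" p] assms(1) by (metis finite_Diff)
  show ?case
    by (rule Suc.prems(1)[of "insert m A"]) (use A m \<open>finite A\<close> in auto)
qed

text \<open>The \<open>k\<close> largest entries are paired with \<open>c\<close>, the next one with
  \<open>d\<close>, and the rest with 0. With \<beta> the entry paired with \<open>d\<close> and
  \<gamma> = \<open>c\<close>, the three conclusions of \<open>powr_entropy_comparison\<close>
  settle the rest, the pair with \<open>d\<close> and the pairs with \<open>c\<close>,
  respectively.\<close>

lemma sum_powr_ge_of_equal_entropy:
  fixes p :: "'a \<Rightarrow> real" and c d \<alpha> :: real
  assumes fin: "finite S" and alpha: "0 < \<alpha>"
    and nonneg: "\<And>i. i \<in> S \<Longrightarrow> 0 \<le> p i"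
    and k: "k \<le> card S" and c: "0 < c" and d: "0 \<le> d" "d < c"
    and sum: "(\<Sum>i\<in>S. p i) = real k * c + d"
    and entropy: "(\<Sum>i\<in>S. p i * ln (p i)) = real k * (c * ln c) + d * ln d"
  shows "real k * c powr \<alpha> + d powr \<alpha> \<le> (\<Sum>i\<in>S. p i powr \<alpha>)"
proof -
  obtain A where A: "A \<subseteq> S" "card A = k" "\<And>i j. i \<in> A \<Longrightarrow> j \<in> S - A \<Longrightarrow> p j \<le> p i"
    using finite_largest_subset[OF fin k] by metis
  have "finite A" using A(1) fin finite_subset by blast
  have split: "sum f S = sum f A + sum f (S - A)" for f :: "'a \<Rightarrow> real"
    using sum.subset_diff[OF A(1) fin, of f] by simp
  show ?thesis
  proof (cases "\<forall>i\<in>S - A. p i = 0")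
    case True
    \<comment> \<open>All mass sits on \<open>A\<close>; this includes \<open>k = card S\<close>.
      The heights of the entries in \<open>A\<close> above the tangent at \<open>c\<close> then add
      up to \<open>?\<phi> d\<close>, which is at most 0 because \<open>d < c\<close>. Being
      nonnegative, they all vanish, so every entry in \<open>A\<close> is \<open>c\<close> and
      \<open>d = 0\<close>.\<close>
    let ?\<phi> = "\<lambda>x. x * ln x - (ln c + 1) * x"
    have "?\<phi> d \<le> 0"
    proof (cases "d = 0")
      case False
      then have "d * ln d \<le> d * (ln c + 1)"
        using d c ln_less_cancel_iff[of d c] by (intro mult_left_mono) linarith+
      then show ?thesis by (simp add: mult.commute)
    qed simp
    have A_sum: "sum p A = real k * c + d"
      "(\<Sum>i\<in>A. p i * ln (p i)) = real k * (c * ln c) + d * ln d"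
      using sum entropy split[of p] split[of "\<lambda>i. p i * ln (p i)"] True by simp_all
    have "(\<Sum>i\<in>A. ?\<phi> (p i) + c) = ?\<phi> d"
      using A(2) A_sum by (simp add: sum.distrib sum_subtractf flip: sum_distrib_left)
        (simp add: algebra_simps)
    moreover have pos: "0 \<le> ?\<phi> (p i) + c" if "i \<in> A" for i
      using x_ln_x_tangent(1)[OF c, of "p i"] nonneg A(1) that by force
    ultimately have sum0: "(\<Sum>i\<in>A. ?\<phi> (p i) + c) = 0"
      using \<open>?\<phi> d \<le> 0\<close> sum_nonneg[of A "\<lambda>i. ?\<phi> (p i) + c"] by force
    then have "?\<phi> (p i) + c = 0" if "i \<in> A" for i
      using pos that \<open>finite A\<close> by (subst (asm) sum_nonneg_eq_0_iff) auto
    then have eq: "p i = c" if "i \<in> A" for i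
      using x_ln_x_tangent(2)[OF c, of "p i"] nonneg A(1) that by force
    then have "d = 0" using A_sum(1) A(2) by simp
    then show ?thesis
      using eq A(2) split[of "\<lambda>i. p i powr \<alpha>"] True by simp
  next
    case False
    then have "S - A \<noteq> {}" by blast
    then obtain j where j: "j \<in> S - A" "\<And>i. i \<in> S - A \<Longrightarrow> p i \<le> p j"
      using finite_arg_max[of "S - A" p] fin by (metis finite_Diff)
    define T where "T = S - A - {j}"
    have split': "sum f S = sum f A + f j + sum f T" for f :: "'a \<Rightarrow> real"
      using split[of f] sum.remove[of "S - A" j f] fin j by (simp add: T_def)
    have T: "i \<in> S" "p i \<le> p j" if "i \<in> T" for i
      using that j by (auto simp: T_def)
    have "0 < p j"
      using False j nonneg by (metis DiffD1 order.antisym not_le)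
    \<comment> \<open>Otherwise \<open>k + 1\<close> entries would be at least \<open>c\<close>,
      giving a total of at least \<open>(k + 1) * c\<close>, more than
      \<open>k * c + d\<close>.\<close>
    have "p j < c"
    proof (rule ccontr)
      assume "\<not> p j < c"
      then have "real k * c \<le> sum p A"
        using A j(1) by (metis (no_types, lifting) not_less order_trans sum_bounded_below)
      moreover have "0 \<le> sum p T"
        using T nonneg by (intro sum_nonneg) auto
      ultimately show False using split'[of p] sum \<open>\<not> p j < c\<close> d by simp
    qed
    obtain l m where
      nonneg': "\<And>x. 0 \<le> x \<Longrightarrow> x \<le> p j \<Longrightarrow> 0 \<le> x powr \<alpha> - l * (x * ln x) - m * x"
      and le: "\<And>x. 0 \<le> x \<Longrightarrow> x \<le> c \<Longrightarrow> x powr \<alpha> - l * (x * ln x) - m * x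
        \<le> p j powr \<alpha> - l * (p j * ln (p j)) - m * p j"
      and ge: "\<And>x. p j \<le> x \<Longrightarrow>
        c powr \<alpha> - l * (c * ln c) - m * c \<le> x powr \<alpha> - l * (x * ln x) - m * x"
      using powr_entropy_comparison[OF alpha \<open>0 < p j\<close> \<open>p j < c\<close>] by blast
    have "real (card A) * (c powr \<alpha> - l * (c * ln c) - m * c)
        \<le> (\<Sum>i\<in>A. p i powr \<alpha> - l * (p i * ln (p i)) - m * p i)"
      using A(3) j(1) by (intro sum_bounded_below ge) auto
    moreover have "0 \<le> (\<Sum>i\<in>T. p i powr \<alpha> - l * (p i * ln (p i)) - m * p i)"
      using T nonneg by (intro sum_nonneg nonneg') auto
    moreover have "l * (\<Sum>i\<in>S. p i * ln (p i)) = l * (real k * (c * ln c) + d * ln d)"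
      "m * sum p S = m * (real k * c + d)"
      using entropy sum by simp_all
    ultimately show ?thesis
      using le[of d] d A(2) unfolding sum_affine split' by (simp add: algebra_simps)
  qed
qed


section \<open>Sums over the entries of the two extremal vectors\<close>

lemma sum_v_vec:
  fixes f :: "real \<Rightarrow> real"
  assumes "1 \<le> n"
  shows "(\<Sum>i=1..n. f (v_vec n a i)) = real (n - 1) * f a + f (1 - real (n - 1) * a)"
proof -
  have "(\<Sum>i=1..n. f (v_vec n a i)) = f (v_vec n a 1) + (\<Sum>i\<in>{1..n} - {1}. f (v_vec n a i))"
    by (rule sum.remove) (use assms in auto)
  also have "(\<Sum>i\<in>{1..n} - {1}. f (v_vec n a i)) = (\<Sum>i\<in>{1..n} - {1}. f a)"
    by (rule sum.cong) (auto simp: v_vec_def)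
  finally show ?thesis
    using assms by (simp add: v_vec_def of_nat_diff)
qed

text \<open>\<open>1 - (i - 1) * c\<close> is the mass left after \<open>i - 1\<close> copies of
  \<open>c\<close>; entry \<open>i\<close> takes \<open>c\<close> of it, or whatever remains, or
  nothing. This form has no floor, so continuity in \<open>c\<close> is evident.\<close>

lemma w_vec_eq_max_min:
  assumes "0 < c" "1 \<le> i"
  shows "w_vec n c i = max 0 (min c (1 - (real i - 1) * c))"
proof -
  define k where "k = \<lfloor>1 / c\<rfloor>"
  have k: "of_int k * c \<le> 1" "1 < (of_int k + 1) * c"
    using floor_correct[of "1 / c"] assms
    by (simp_all only: k_def pos_le_divide_eq pos_divide_less_eq of_int_add of_int_1)
  consider "int i \<le> k" | "int i = k + 1" | "k + 2 \<le> int i" by linarith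
  then show ?thesis
  proof cases
    case 1
    then have "real i * c \<le> of_int k * c"
      using assms by (intro mult_right_mono) linarith+
    then have "min c (1 - (real i - 1) * c) = c"
      using k unfolding left_diff_distrib by linarith
    then show ?thesis
      using 1 assms by (simp add: w_vec_def k_def[symmetric])
  next
    case 2
    then have i_eq: "real i - 1 = of_int k" by linarith
    have "max 0 (min c (1 - of_int k * c)) = 1 - of_int k * c"
      using k unfolding distrib_right by simp
    then show ?thesis
      using 2 assms by (simp add: w_vec_def k_def[symmetric] i_eq)
  next
    case 3
    then have "(of_int k + 1) * c \<le> (real i - 1) * c"
      using assms by (intro mult_right_mono) linarith+
    then have "max 0 (min c (1 - (real i - 1) * c)) = 0"
      using k by linarith
    then show ?thesis
      using 3 by (simp add: w_vec_def k_def[symmetric])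
  qed
qed

text \<open>The condition \<open>f 0 = 0\<close> removes the trailing zeros; \<open>x * ln x\<close>
  and \<open>x powr \<alpha>\<close> both satisfy it.\<close>

lemma sum_w_vec:
  fixes f :: "real \<Rightarrow> real"
  assumes "0 < c" "1 / real n \<le> c" "1 \<le> n" "f 0 = 0"
  shows "(\<Sum>i=1..n. f (w_vec n c i))
    = real (nat \<lfloor>1 / c\<rfloor>) * f c + f (1 - real (nat \<lfloor>1 / c\<rfloor>) * c)"
proof -
  define k where "k = nat \<lfloor>1 / c\<rfloor>"
  have floor: "\<lfloor>1 / c\<rfloor> = int k"
    using assms by (simp add: k_def)
  have "1 / c \<le> real n"
    using assms by (simp add: field_simps)
  then have "k \<le> n"
    using floor by linarith
  have "(\<Sum>i=1..n. f (w_vec n c i)) = (\<Sum>i=1..k. f (w_vec n c i)) + (\<Sum>i=k+1..n. f (w_vec n c i))"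
    using \<open>k \<le> n\<close> by (metis Suc_eq_plus1 add.commute le_add1 le_add_diff_inverse sum.ub_add_nat)
  also have "(\<Sum>i=1..k. f (w_vec n c i)) = real k * f c"
    by (simp add: w_vec_def floor)
  also have "(\<Sum>i=k+1..n. f (w_vec n c i)) = f (1 - real k * c)"
  proof (cases "k = n")
    \<comment> \<open>There is no position \<open>k + 1\<close> to hold the remainder, but
      \<open>c = 1 / n\<close> makes the remainder 0.\<close>
    case True
    then have "1 - real k * c = 0"
      using floor_correct[of "1 / c"] floor assms by (simp add: field_simps)
    then show ?thesis using True assms by simp
  next
    case False
    then have "(\<Sum>i=k+1..n. f (w_vec n c i)) = (\<Sum>i\<in>{k+1}. f (w_vec n c i))"
      using \<open>k \<le> n\<close> assms by (intro sum.mono_neutral_right) (auto simp: w_vec_def floor)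
    then show ?thesis by (simp add: w_vec_def floor)
  qed
  finally show ?thesis unfolding k_def .
qed

section \<open>Range of the entropy, and preimages under \<open>H_v\<close> and
  \<open>H_w\<close>\<close>

lemma prob_simplex_le_1:
  assumes "p \<in> prob_simplex n" "i \<in> {1..n}"
  shows "p i \<le> 1"
  using member_le_sum[of i "{1..n}" p] assms by (auto simp: prob_simplex_def)

lemma shannon_entropy_nonneg:
  assumes "p \<in> prob_simplex n"
  shows "0 \<le> shannon_entropy n p"
proof -
  have "p i * ln (p i) \<le> 0" if "i \<in> {1..n}" for i
  proof (cases "p i = 0")
    case False
    then have "0 < p i" using assms that by (force simp: prob_simplex_def)
    then show ?thesis
      using prob_simplex_le_1[OF assms that] by (simp add: mult_nonneg_nonpos)
  qed simp
  then have "(\<Sum>i=1..n. p i * ln (p i)) \<le> 0"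
    by (rule sum_nonpos)
  then show ?thesis
    by (simp add: shannon_entropy_def)
qed

text \<open>Sum of the tangent bounds for \<open>x * ln x\<close> at the uniform entry
  \<open>1 / n\<close>.\<close>

lemma shannon_entropy_le_ln:
  assumes "1 \<le> n" "p \<in> prob_simplex n"
  shows "shannon_entropy n p \<le> ln (real n)"
proof -
  have "real (card {1..n}) * - (1 / real n)
      \<le> (\<Sum>i=1..n. p i * ln (p i) - (ln (1 / real n) + 1) * p i)"
    using assms by (intro sum_bounded_below x_ln_x_tangent(1)) (auto simp: prob_simplex_def)
  also have "\<dots> = (\<Sum>i=1..n. p i * ln (p i)) - (ln (1 / real n) + 1) * sum p {1..n}"
    by (simp add: sum_subtractf sum_distrib_left)
  finally show ?thesis
    using assms by (simp add: shannon_entropy_def prob_simplex_def ln_div)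
qed

lemma continuous_on_shannon_entropy:
  assumes "\<And>i. i \<in> {1..n} \<Longrightarrow> continuous_on X (\<lambda>x. q x i)"
    and "\<And>i x. i \<in> {1..n} \<Longrightarrow> x \<in> X \<Longrightarrow> 0 \<le> q x i"
  shows "continuous_on X (\<lambda>x. shannon_entropy n (q x))"
  unfolding shannon_entropy_def
proof (intro continuous_on_minus continuous_on_sum)
  fix i assume "i \<in> {1..n}"
  then show "continuous_on X (\<lambda>x. q x i * ln (q x i))"
    using assms by (intro continuous_on_compose2[OF continuous_on_x_ln_x]) auto
qed

text \<open>\<open>H_v n\<close> is continuous with endpoint values 0 and \<open>ln n\<close>, so
  the intermediate value theorem puts \<open>h\<close> in the image of the interval, and
  \<open>inv_into\<close> returns a preimage there.\<close>

lemma H_v_inv: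
  assumes "2 \<le> n" "0 \<le> h" "h \<le> ln (real n)"
  shows "H_v_inv n h \<in> {0..1 / real n}" "H_v n (H_v_inv n h) = h"
proof -
  have H_v: "H_v n a = - (real (n - 1) * (a * ln a)
      + (1 - real (n - 1) * a) * ln (1 - real (n - 1) * a))" for a
    using sum_v_vec[of n "\<lambda>x. x * ln x"] assms by (simp add: H_v_def shannon_entropy_def)
  have "continuous_on {0..1 / real n} (H_v n)"
    unfolding H_v_def
  proof (rule continuous_on_shannon_entropy)
    show "continuous_on {0..1 / real n} (\<lambda>x. v_vec n x i)" for i
      unfolding v_vec_def by (cases "i = 1") (auto intro!: continuous_intros)
    show "0 \<le> v_vec n x i" if "x \<in> {0..1 / real n}" for i x
    proof -
      have "(real n - 1) * x \<le> (real n - 1) * (1 / real n)"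
        using that assms by (intro mult_left_mono) auto
      also have "\<dots> \<le> 1" using assms by simp
      finally show ?thesis using that by (simp add: v_vec_def)
    qed
  qed
  moreover have "H_v n 0 = 0" by (simp add: H_v)
  moreover have "H_v n (1 / real n) = ln (real n)"
    using assms by (simp add: H_v of_nat_diff ln_div field_simps)
  ultimately have "h \<in> H_v n ` {0..1 / real n}"
    using IVT'[of "H_v n" 0 h "1 / real n"] assms by force
  then show "H_v_inv n h \<in> {0..1 / real n}" "H_v n (H_v_inv n h) = h"
    unfolding H_v_inv_def by (auto simp only: inv_into_into f_inv_into_f)
qed

lemma H_w_inv:
  assumes "2 \<le> n" "0 \<le> h" "h \<le> ln (real n)"
  shows "H_w_inv n h \<in> {1 / real n..1}" "H_w n (H_w_inv n h) = h"
proof -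
  have pos: "0 < c" if "c \<in> {1 / real n..1}" for c
  proof -
    have "0 < 1 / real n" using assms by simp
    also have "\<dots> \<le> c" using that by simp
    finally show ?thesis .
  qed
  have H_w: "H_w n c = - (real (nat \<lfloor>1 / c\<rfloor>) * (c * ln c)
      + (1 - real (nat \<lfloor>1 / c\<rfloor>) * c) * ln (1 - real (nat \<lfloor>1 / c\<rfloor>) * c))"
    if "c \<in> {1 / real n..1}" for c
    using sum_w_vec[of c n "\<lambda>x. x * ln x"] assms that pos[OF that]
    by (simp add: H_w_def shannon_entropy_def)
  \<comment> \<open>Continuity is shown for the floor-free form of the entries and then carried over
    to \<open>H_w n\<close>.\<close>
  have "continuous_on {1 / real n..1} (\<lambda>c. shannon_entropy n (\<lambda>i. max 0 (min c (1 - (real i - 1) * c))))"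
    by (intro continuous_on_shannon_entropy continuous_intros) auto
  also have "?this \<longleftrightarrow> continuous_on {1 / real n..1} (H_w n)"
    unfolding H_w_def shannon_entropy_def
    by (intro continuous_on_cong refl arg_cong[of _ _ uminus] sum.cong)
      (auto simp: w_vec_eq_max_min pos)
  finally have "continuous_on {1 / real n..1} (H_w n)" .
  moreover have "H_w n 1 = 0" using assms by (simp add: H_w)
  moreover have "H_w n (1 / real n) = ln (real n)"
    using assms by (simp add: H_w ln_div)
  ultimately have "h \<in> H_w n ` {1 / real n..1}"
    using IVT2'[of "H_w n" 1 h "1 / real n"] assms by force
  then show "H_w_inv n h \<in> {1 / real n..1}" "H_w n (H_w_inv n h) = h"
    unfolding H_w_inv_def by (auto simp only: inv_into_into f_inv_into_f)
qed

section \<open>The two norm bounds\<close>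

theorem theorem1:
  fixes n :: nat and p :: "nat \<Rightarrow> real" and \<alpha> :: real
  assumes "2 \<le> n"
    and "p \<in> prob_simplex n"
    and "0 < \<alpha>"
  shows "alpha_norm n \<alpha> (w_bar n p) \<le> alpha_norm n \<alpha> p
       \<and> alpha_norm n \<alpha> p \<le> alpha_norm n \<alpha> (v_bar n p)"
proof
  let ?h = "shannon_entropy n p"
  have h: "0 \<le> ?h" "?h \<le> ln (real n)"
    using assms shannon_entropy_nonneg shannon_entropy_le_ln by simp_all
  have nonneg: "\<And>i. i \<in> {1..n} \<Longrightarrow> 0 \<le> p i" and sum: "sum p {1..n} = 1"
    using assms by (auto simp: prob_simplex_def)
  define c where "c = H_w_inv n ?h"
  define k where "k = nat \<lfloor>1 / c\<rfloor>"
  have c: "1 / real n \<le> c" "c \<le> 1" "H_w n c = ?h"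
    using H_w_inv[OF assms(1) h] by (auto simp: c_def)
  have "0 < 1 / real n" using assms by simp
  with c have "0 < c" by linarith
  \<comment> \<open>These bounds say that the remainder \<open>1 - k * c\<close>, in the role of
    \<open>d\<close>, is nonnegative and less than \<open>c\<close>.\<close>
  have floor: "real k \<le> 1 / c" "1 / c < real k + 1"
    using floor_correct[of "1 / c"] \<open>0 < c\<close> by (auto simp: k_def)
  have "1 / c \<le> real n" using c assms \<open>0 < c\<close> by (simp add: field_simps)
  with floor have "k \<le> n" by linarith
  have sum_w: "(\<Sum>i=1..n. f (w_vec n c i)) = real k * f c + f (1 - real k * c)"
    if "f 0 = 0" for f :: "real \<Rightarrow> real"
    using sum_w_vec[of c n f] c \<open>0 < c\<close> assms that by (simp add: k_def)
  have "real k * c powr \<alpha> + (1 - real k * c) powr \<alpha> \<le> (\<Sum>i=1..n. p i powr \<alpha>)"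
  proof (rule sum_powr_ge_of_equal_entropy)
    show "(\<Sum>i=1..n. p i * ln (p i)) = real k * (c * ln c) + (1 - real k * c) * ln (1 - real k * c)"
      using c(3) sum_w[of "\<lambda>x. x * ln x"] by (simp add: H_w_def shannon_entropy_def)
  qed (use nonneg sum assms \<open>k \<le> n\<close> \<open>0 < c\<close> floor in \<open>auto simp: field_simps\<close>)
  then show "alpha_norm n \<alpha> (w_bar n p) \<le> alpha_norm n \<alpha> p"
    unfolding alpha_norm_def w_bar_def c_def[symmetric]
    using sum_w[of "\<lambda>x. x powr \<alpha>"] assms by (intro powr_mono2) (auto intro: sum_nonneg)
  define a where "a = H_v_inv n ?h"
  have a: "0 \<le> a" "a \<le> 1 / real n" "H_v n a = ?h"
    using H_v_inv[OF assms(1) h] by (auto simp: a_def)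
  have sum_v: "(\<Sum>i=1..n. f (v_vec n a i)) = real (n - 1) * f a + f (1 - real (n - 1) * a)"
    for f :: "real \<Rightarrow> real"
    using sum_v_vec assms by simp
  obtain j where j: "j \<in> {1..n}" "\<And>i. i \<in> {1..n} \<Longrightarrow> p i \<le> p j"
    using finite_arg_max[of "{1..n}" p] assms by auto
  have "(\<Sum>i=1..n. p i powr \<alpha>)
      \<le> real (card {1..n} - 1) * a powr \<alpha> + (1 - real (card {1..n} - 1) * a) powr \<alpha>"
  proof (rule sum_powr_le_of_equal_entropy[where j = j])
    \<comment> \<open>Equivalent to \<open>n * a \<le> 1\<close>: on the chosen branch of the
      inverse the single entry of the vector \<open>v\<close> is its largest.\<close>
    show "a \<le> 1 - real (card {1..n} - 1) * a"
      using a assms by (simp add: of_nat_diff field_simps)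
    show "(\<Sum>i=1..n. p i * ln (p i)) = real (card {1..n} - 1) * (a * ln a)
        + (1 - real (card {1..n} - 1) * a) * ln (1 - real (card {1..n} - 1) * a)"
      using a(3) sum_v[of "\<lambda>x. x * ln x"] by (simp add: H_v_def shannon_entropy_def)
  qed (use nonneg sum assms j a in auto)
  then show "alpha_norm n \<alpha> p \<le> alpha_norm n \<alpha> (v_bar n p)"
    unfolding alpha_norm_def v_bar_def a_def[symmetric]
    using sum_v[of "\<lambda>x. x powr \<alpha>"] assms by (intro powr_mono2) (auto intro: sum_nonneg)
qed

end
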